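(* Let $f,g\in\mathbb{Q}[x]$ both have only simple rational roots, with $\deg(f)\le\deg(g)$, and suppose the equation $f(x)=g(y)$ has infinitely many rational solutions with a bounded denominator. Suppose $f=\varphi(F(\kappa))$ and $g=\varphi(G(\lambda))$, where $\kappa,\lambda\in\mathbb{Q}[x]$ are linear, $\varphi\in\mathbb{Q}[x]$, and $(F,G)$ is a standard pair over $\mathbb{Q}$ of the third or fourth kind such that $F(x)=G(y)$ has infinitely many rational solutions with a bounded denominator. Then $\deg(F)\le 2$.
   Context: "Only simple rational roots" means all complex roots are rational and pairwise distinct. An equation $P(x)=Q(y)$ has infinitely many rational solutions with a bounded denominator if for some positive integer $\Delta$ there are infinitely many $(x,y)\in\mathbb{Q}^2$ with $P(x)=Q(y)$ and $(\Delta x,\Delta y)\in\mathbb{Z}^2$. Dickson polynomial: $D_\mu(x,\delta)=\sum_{i=0}^{\lfloor \mu/2\rfloor}\frac{\mu}{\mu-i}\binom{\mu-i}{i}(-\delta)^i x^{\mu-2i}$. $(F,G)$ is a standard pair of the third kind if $(F,G)$ or $(G,F)$ equals $(D_\mu(x,\alpha^\nu),D_\nu(x,\alpha^\mu))$ with $\alpha\in\mathbb{Q}\setminus\{0\}$, positive integers $\mu,\nu$, $\gcd(\mu,\nu)=1$; of the fourth kind if $(F,G)$ or $(G,F)$ equals $(\alpha^{-\mu/2}D_\mu(x,\alpha),-\beta^{-\nu/2}D_\nu(x,\beta))$ with $\alpha,\beta\in\mathbb{Q}\setminus\{0\}$, positive integers $\mu,\nu$, $\gcd(\mu,\nu)=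2$.
   Formalization: The polynomial f is additionally assumed nonconstant (hence g too): for f = g = φ = 1, F = D_3(x,1), G = D_5(x,1), all stated hypotheses hold but deg(F) = 3. *)

theory Defs
  imports Complex_Main "HOL-Computational_Algebra.Polynomial"
begin

text \<open>The zero polynomial fails this condition, but nonzero constants satisfy it vacuously;
  where a nonconstant polynomial is meant, positivity of the degree is a separate hypothesis.\<close>

definition only_simple_rational_roots :: "rat poly \<Rightarrow> bool" where
  "only_simple_rational_roots f \<longleftrightarrow>
     (\<forall>z::complex. poly (map_poly of_rat f) z = 0 \<longrightarrow>
        z \<in> \<rat> \<and> order z (map_poly of_rat f) = 1)"

definition inf_many_sols_bounded_denom :: "rat poly \<Rightarrow> rat poly \<Rightarrow> bool" where
  "inf_many_sols_bounded_denom P Q \<longleftrightarrow>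
     (\<exists>\<Delta>::int. \<Delta> > 0 \<and>
        infinite {(x, y). poly P x = poly Q y \<and> of_int \<Delta> * x \<in> \<int> \<and> of_int \<Delta> * y \<in> \<int>})"

text \<open>Only used for positive \<open>\<mu>\<close>; then \<open>i \<le> \<mu> div 2\<close> keeps the subtractions
  \<open>\<mu> - i\<close> and \<open>\<mu> - 2 * i\<close> from truncating and the denominator from vanishing.\<close>

definition dickson :: "nat \<Rightarrow> rat \<Rightarrow> rat poly" where
  "dickson \<mu> \<delta> =
     (\<Sum>i\<le>\<mu> div 2. monom (of_nat \<mu> / of_nat (\<mu> - i) * of_nat ((\<mu> - i) choose i) * (- \<delta>) ^ i)
                          (\<mu> - 2 * i))"

definition standard_pair_third_kind :: "rat poly \<Rightarrow> rat poly \<Rightarrow> bool" where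
  "standard_pair_third_kind F G \<longleftrightarrow>
     (\<exists>\<alpha> \<mu> \<nu>. \<alpha> \<noteq> 0 \<and> \<mu> > 0 \<and> \<nu> > 0 \<and> gcd \<mu> \<nu> = 1 \<and>
        ((F, G) = (dickson \<mu> (\<alpha> ^ \<nu>), dickson \<nu> (\<alpha> ^ \<mu>)) \<or>
         (G, F) = (dickson \<mu> (\<alpha> ^ \<nu>), dickson \<nu> (\<alpha> ^ \<mu>))))"

text \<open>The exponents \<open>- \<mu> / 2\<close> and \<open>- \<nu> / 2\<close> are integers because \<open>gcd \<mu> \<nu> = 2\<close>.\<close>

definition standard_pair_fourth_kind :: "rat poly \<Rightarrow> rat poly \<Rightarrow> bool" where
  "standard_pair_fourth_kind F G \<longleftrightarrow>
     (\<exists>\<alpha> \<beta> \<mu> \<nu>. \<alpha> \<noteq> 0 \<and> \<beta> \<noteq> 0 \<and> \<mu> > 0 \<and> \<nu> > 0 \<and> gcd \<mu> \<nu> = 2 \<and>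
        ((F, G) = (smult (\<alpha> powi (- int (\<mu> div 2))) (dickson \<mu> \<alpha>),
                   - smult (\<beta> powi (- int (\<nu> div 2))) (dickson \<nu> \<beta>)) \<or>
         (G, F) = (smult (\<alpha> powi (- int (\<mu> div 2))) (dickson \<mu> \<alpha>),
                   - smult (\<beta> powi (- int (\<nu> div 2))) (dickson \<nu> \<beta>))))"

end

theory Submission
  imports Defs "HOL-Computational_Algebra.Fundamental_Theorem_Algebra"
begin

text \<open>
  If \<open>r\<close> is a complex root of \<open>\<phi>\<close>, then every root of \<open>F - r\<close> and of \<open>G - r\<close> comes from a root of
  \<open>f\<close> or \<open>g\<close>, so \<open>r\<close> is rational and both polynomials have only simple rational roots.
  Up to scaling they are \<open>D\<^sub>n(x, \<delta>) - R\<close>, whose roots are \<open>2 \<surd>\<delta> cos (\<theta> + 2 \<pi> k / n)\<close>. For \<open>n \<ge> 3\<close>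
  rationality of all of them forces \<open>2 cos (2 \<pi> / n)\<close> to be rational, that is \<open>n \<in> {3, 4, 6}\<close>, and
  makes \<open>4 \<delta>\<^sup>n - R\<^sup>2\<close> a square if \<open>n = 4\<close> and three times a square otherwise.
  When the gcd of the two indices is 1 or 2, exactly one of them is 4, while
  \<open>4 \<delta>\<^sup>n - R\<^sup>2\<close> is the same for both up to squares; hence it vanishes, and
  \<open>D\<^sub>4(x, \<delta>) - R\<close> has a multiple root.
\<close>

section \<open>Coefficients of Dickson polynomials and power sums\<close>

definition dickson_coeff :: "nat \<Rightarrow> nat \<Rightarrow> 'a::field_char_0" where
  "dickson_coeff n i = of_nat n / of_nat (n - i) * of_nat ((n - i) choose i)"

text \<open>Here \<open>n - i < i\<close>, so the binomial vanishes. This lets sums run to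
  \<open>n\<close> instead of \<open>n div 2\<close>: terms where \<open>n - 2 * i\<close> truncates
  contribute nothing.\<close>

lemma dickson_coeff_eq_0:
  assumes "0 < n" and "n < 2 * i"
  shows "dickson_coeff n i = 0"
  using assms by (auto simp: dickson_coeff_def)

lemma dickson_coeff_0 [simp]: "0 < n \<Longrightarrow> dickson_coeff n 0 = 1"
  by (simp add: dickson_coeff_def)

text \<open>Coefficient form of the recurrence D_(n+2) = x D_(n+1) - \<delta> D_n.\<close>

lemma dickson_coeff_rec:
  assumes "0 < n"
  shows "dickson_coeff (n + 2) (Suc i) =
    dickson_coeff (n + 1) (Suc i) + (dickson_coeff n i :: 'a::field_char_0)"
proof (cases "2 * i \<le> n")
  case True
  define m where "m = n - i"
  have n: "n = m + i" and m: "m > 0" "i \<le> m" using True assms by (auto simp: m_def)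
  define C where "C = (of_nat (m choose i) :: 'a)"
  define j where "j = (of_nat i :: 'a)"
  define l where "l = (of_nat m :: 'a)"
  have nz: "l \<noteq> 0" "l + 1 \<noteq> 0" "j + 1 \<noteq> 0" "1 + l \<noteq> 0" "1 + j \<noteq> 0"
    using m of_nat_neq_0[of i, where 'a = 'a] of_nat_neq_0[of m, where 'a = 'a]
    by (auto simp: l_def j_def add.commute)
  \<comment> \<open>Absorption turns both shifted binomials into multiples of \<open>C\<close>, so
    the claim becomes an identity of rational functions in \<open>l\<close> and
    \<open>j\<close>.\<close>
  have "of_nat (Suc i * (Suc m choose Suc i)) = (of_nat (Suc m * (m choose i)) :: 'a)"
    by (simp only: Suc_times_binomial)
  then have A: "of_nat (Suc m choose Suc i) = (l + 1) * C / (j + 1)"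
    using nz by (simp add: field_simps C_def l_def j_def)
  have "of_nat (Suc i * (m choose Suc i)) = (of_nat ((m - i) * (m choose i)) :: 'a)"
    by (simp only: binomial_absorption binomial_absorb_comp)
  then have B: "of_nat (m choose Suc i) = (l - j) * C / (j + 1)"
    using nz m by (simp add: field_simps C_def l_def j_def of_nat_diff)
  have "dickson_coeff (n + 2) (Suc i) = (l + j + 2) / (l + 1) * ((l + 1) * C / (j + 1))"
    unfolding A[symmetric] using n by (simp add: dickson_coeff_def l_def j_def algebra_simps)
  moreover have "dickson_coeff (n + 1) (Suc i) = (l + j + 1) / l * ((l - j) * C / (j + 1))"
    unfolding B[symmetric] using n by (simp add: dickson_coeff_def l_def j_def algebra_simps)
  moreover have "dickson_coeff n i = (l + j) / l * C"
    using n by (simp add: dickson_coeff_def l_def j_def C_def)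
  moreover have "(l + j + 2) / (l + 1) * ((l + 1) * C / (j + 1)) =
      (l + j + 1) / l * ((l - j) * C / (j + 1)) + (l + j) / l * C"
    using nz by (simp add: divide_simps) (simp add: algebra_simps)
  ultimately show ?thesis by simp
next
  case False
  then show ?thesis using assms by (simp add: dickson_coeff_eq_0)
qed

text \<open>Waring's formula: power sums satisfy p_(k+2) = (u + v) p_(k+1) - u v p_k, which is the
  recurrence of the coefficients.\<close>

lemma sum_dickson_coeff:
  fixes u v :: "'a::field_char_0"
  assumes "0 < n"
  shows "(\<Sum>i\<le>n. dickson_coeff n i * (- (u * v)) ^ i * (u + v) ^ (n - 2 * i)) = u ^ n + v ^ n"
  using assms
proof (induction n rule: less_induct)
  case (less n)
  \<comment> \<open>The base cases are 1 and 2 rather than 0 and 1: at index 0 the coefficient is 0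
    / 0 = 0, whereas the power sum is 2.\<close>
  consider "n = 1" | "n = 2" | k where "n = k + 2" "0 < k"
  proof -
    have "n = 1 \<or> n = 2 \<or> n = (n - 2) + 2 \<and> 0 < n - 2" using less.prems by arith
    then show thesis using that by blast
  qed
  then show ?case
  proof cases
    case 1
    then show ?thesis by (simp add: dickson_coeff_def)
  next
    case 2
    then show ?thesis
      by (simp add: dickson_coeff_def numeral_2_eq_2) (simp add: algebra_simps)
  next
    case (3 k)
    define t where "t = - (u * v)"
    define s where "s = u + v"
    have IH1: "(\<Sum>i\<le>k + 1. dickson_coeff (k + 1) i * t ^ i * s ^ (k + 1 - 2 * i)) = u ^ (k + 1) + v ^ (k + 1)"
      and IH0: "(\<Sum>i\<le>k. dickson_coeff k i * t ^ i * s ^ (k - 2 * i)) = u ^ k + v ^ k"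
      unfolding t_def s_def using 3 less.IH[of "k + 1"] less.IH[of k] by simp_all
    \<comment> \<open>Raising the exponent by one is correct only without truncation; in the
      remaining terms the coefficient is 0.\<close>
    have "s * (dickson_coeff (k + 1) i * t ^ i * s ^ (k + 1 - 2 * i)) =
        dickson_coeff (k + 1) i * t ^ i * s ^ (k + 2 - 2 * i)" for i
    proof (cases "2 * i \<le> k + 1")
      case True
      then have "k + 2 - 2 * i = Suc (k + 1 - 2 * i)" by simp
      then show ?thesis by simp
    qed (use 3 in \<open>simp add: dickson_coeff_eq_0\<close>)
    then have "s * (u ^ (k + 1) + v ^ (k + 1)) =
        (\<Sum>i\<le>k + 1. dickson_coeff (k + 1) i * t ^ i * s ^ (k + 2 - 2 * i))"
      unfolding IH1[symmetric] sum_distrib_left by (rule sum.cong[OF refl])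
    also have "\<dots> = (\<Sum>i\<le>Suc (k + 1). dickson_coeff (k + 1) i * t ^ i * s ^ (k + 2 - 2 * i))"
      by (simp add: dickson_coeff_eq_0)
    also have "\<dots> = s ^ (k + 2) +
        (\<Sum>i\<le>k + 1. dickson_coeff (k + 1) (Suc i) * t ^ Suc i * s ^ (k - 2 * i))"
      by (subst sum.atMost_Suc_shift) simp
    finally have S1: "s * (u ^ (k + 1) + v ^ (k + 1)) = s ^ (k + 2) +
        (\<Sum>i\<le>k + 1. dickson_coeff (k + 1) (Suc i) * t ^ Suc i * s ^ (k - 2 * i))" .
    have "t * (u ^ k + v ^ k) = (\<Sum>i\<le>k. dickson_coeff k i * t ^ Suc i * s ^ (k - 2 * i))"
      unfolding IH0[symmetric] sum_distrib_left by (simp add: algebra_simps)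
    also have "\<dots> = (\<Sum>i\<le>k + 1. dickson_coeff k i * t ^ Suc i * s ^ (k - 2 * i))"
      using 3 by (simp add: dickson_coeff_eq_0)
    finally have S0: "t * (u ^ k + v ^ k) =
        (\<Sum>i\<le>k + 1. dickson_coeff k i * t ^ Suc i * s ^ (k - 2 * i))" .
    have "(\<Sum>i\<le>n. dickson_coeff n i * t ^ i * s ^ (n - 2 * i)) =
        (\<Sum>i\<le>Suc (k + 1). dickson_coeff (k + 2) i * t ^ i * s ^ (k + 2 - 2 * i))"
      using 3 by simp
    also have "\<dots> = s ^ (k + 2) +
        (\<Sum>i\<le>k + 1. dickson_coeff (k + 2) (Suc i) * t ^ Suc i * s ^ (k - 2 * i))"
      by (subst sum.atMost_Suc_shift) simp
    also have "\<dots> = s * (u ^ (k + 1) + v ^ (k + 1)) + t * (u ^ k + v ^ k)"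
      unfolding S1 S0 add.assoc sum.distrib[symmetric]
      using \<open>0 < k\<close> by (simp only: dickson_coeff_rec ring_distribs)
    also have "\<dots> = u ^ n + v ^ n"
      using 3 by (simp add: t_def s_def algebra_simps)
    finally show ?thesis unfolding t_def s_def .
  qed
qed

section \<open>Extension of scalars from the rationals, and evaluation of Dickson
  polynomials\<close>

lemma map_poly_of_rat_add:
  "map_poly of_rat (p + q) = map_poly of_rat p + (map_poly of_rat q :: 'a::field_char_0 poly)"
  by (intro poly_eqI) (simp add: coeff_map_poly of_rat_add)

lemma map_poly_of_rat_mult:
  "map_poly of_rat (p * q) = map_poly of_rat p * (map_poly of_rat q :: 'a::field_char_0 poly)"
  by (intro poly_eqI) (simp add: coeff_map_poly coeff_mult of_rat_sum of_rat_mult)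

lemma map_poly_of_rat_sum:
  "map_poly of_rat (sum h A) = (\<Sum>i\<in>A. map_poly of_rat (h i) :: 'a::field_char_0 poly)"
  by (intro poly_eqI) (simp add: coeff_map_poly coeff_sum of_rat_sum)

lemma map_poly_of_rat_smult:
  "map_poly of_rat (smult c p) = smult (of_rat c) (map_poly of_rat p :: 'a::field_char_0 poly)"
  by (intro poly_eqI) (simp add: coeff_map_poly of_rat_mult)

lemma map_poly_of_rat_pderiv:
  "map_poly of_rat (pderiv p) = pderiv (map_poly of_rat p :: 'a::field_char_0 poly)"
proof (intro poly_eqI)
  fix n
  have "of_rat (of_nat (Suc n) * coeff p (Suc n)) = (of_nat (Suc n) * of_rat (coeff p (Suc n)) :: 'a)"
    unfolding of_rat_mult of_rat_of_nat_eq ..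
  then show "coeff (map_poly of_rat (pderiv p)) n = coeff (pderiv (map_poly of_rat p :: 'a poly)) n"
    by (simp only: coeff_map_poly of_rat_0 coeff_pderiv)
qed

lemma map_poly_of_rat_pcompose:
  "map_poly of_rat (pcompose p q) =
   pcompose (map_poly of_rat p) (map_poly of_rat q :: 'a::field_char_0 poly)"
  by (induction p) (simp_all add: pcompose_pCons map_poly_pCons map_poly_of_rat_add map_poly_of_rat_mult)

lemma poly_map_poly_of_rat:
  "poly (map_poly of_rat p) (of_rat x) = (of_rat (poly p x) :: 'a::field_char_0)"
  by (induction p) (simp_all add: map_poly_pCons of_rat_add of_rat_mult)

lemma degree_map_poly_of_rat [simp]:
  "degree (map_poly of_rat p :: 'a::field_char_0 poly) = degree p"
  by (rule degree_map_poly) simp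

lemma poly_dickson:
  fixes u v :: "'a::field_char_0"
  assumes "0 < n" and "u * v = of_rat \<delta>"
  shows "poly (map_poly of_rat (dickson n \<delta>)) (u + v) = u ^ n + v ^ n"
proof -
  have "poly (map_poly of_rat (dickson n \<delta>)) (u + v) =
      (\<Sum>i\<le>n div 2. dickson_coeff n i * (- (u * v)) ^ i * (u + v) ^ (n - 2 * i))"
    unfolding dickson_def map_poly_of_rat_sum poly_sum
    by (simp add: map_poly_monom poly_monom dickson_coeff_def assms of_rat_mult of_rat_divide
        of_rat_power of_rat_minus of_rat_diff)
  also have "\<dots> = (\<Sum>i\<le>n. dickson_coeff n i * (- (u * v)) ^ i * (u + v) ^ (n - 2 * i))"
    using \<open>0 < n\<close> by (intro sum.mono_neutral_left) (auto simp: dickson_coeff_eq_0)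
  finally show ?thesis unfolding sum_dickson_coeff[OF \<open>0 < n\<close>] .
qed

lemma degree_dickson_le: "degree (dickson n \<delta>) \<le> n"
  unfolding dickson_def
  by (intro degree_sum_le) (auto intro: order_trans[OF degree_monom_le])

lemma dickson_4: "dickson 4 \<delta> = [:2 * \<delta>\<^sup>2, 0, -4 * \<delta>, 0, 1:]"
proof -
  have "{..4 div 2 :: nat} = {0, 1, 2}" by auto
  moreover have "(3 choose 1) = (3::nat)" "(2 choose 2) = (1::nat)" by simp_all
  ultimately show ?thesis
    by (simp add: dickson_def monom_altdef eval_nat_numeral)
qed

section \<open>Roots of unity with rational trace\<close>

text \<open>Write c = a / b in lowest terms. For k > 0 the number b^k (z^k + z^(-k)) is an integer
  congruent to a^k modulo b. At k = n it equals 2 b^n, so b divides a^n and must be 1.\<close>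

lemma rational_trace_of_root_of_unity:
  fixes z c :: "'a::field_char_0"
  assumes "0 < n" and "z ^ n = 1" and c: "c = z + 1 / z" and "c \<in> \<rat>"
  shows "c \<in> \<int>"
proof -
  obtain a b where ab: "c = of_int a / of_int b" "b > 0" "coprime a b"
    using \<open>c \<in> \<rat>\<close> by (metis Rats_cases')
  have z: "z \<noteq> 0" using assms by (auto simp: power_0_left)
  define w where "w = 1 / z"
  have zw: "z * w = 1" using z by (simp add: w_def)
  define s where "s k = (of_int b ^ k * (z ^ k + w ^ k) :: 'a)" for k
  have rec: "s (Suc (Suc k)) = of_int a * s (Suc k) - of_int b ^ 2 * s k" for k
  proof -
    have a: "of_int a = of_int b * (z + w)" using ab c by (simp add: w_def field_simps)
    have "s (Suc (Suc k)) - (of_int a * s (Suc k) - of_int b ^ 2 * s k) =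
        of_int b ^ 2 * s k * (1 - z * w)"
      unfolding s_def a by (simp add: power2_eq_square algebra_simps)
    then show ?thesis unfolding zw by simp
  qed
  \<comment> \<open>The congruence starts at exponent 1, because \<open>s 0\<close> is 2 while
    \<open>a ^ 0\<close> is 1.\<close>
  have "(\<exists>t::int. s (Suc k) = of_int t \<and> b dvd t - a ^ Suc k) \<and>
        (\<exists>t::int. s (Suc (Suc k)) = of_int t \<and> b dvd t - a ^ Suc (Suc k))" for k
  proof (induction k)
    case 0
    have s1: "s (Suc 0) = of_int a" using ab c by (simp add: s_def w_def)
    have s2: "s (Suc (Suc 0)) = of_int (a * a - b\<^sup>2 * 2)"
      unfolding rec s1 by (simp add: s_def)
    show ?case
      by (intro conjI exI, rule s1, simp, rule s2) (simp add: power2_eq_square)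
  next
    case (Suc k)
    then obtain t t' where t: "s (Suc k) = of_int t" "s (Suc (Suc k)) = of_int t'"
      "b dvd t' - a ^ Suc (Suc k)" by blast
    have eq: "s (Suc (Suc (Suc k))) = of_int (a * t' - b\<^sup>2 * t)"
      unfolding rec[of "Suc k"] t by simp
    have "a * t' - b\<^sup>2 * t - a ^ Suc (Suc (Suc k)) = a * (t' - a ^ Suc (Suc k)) - b * (b * t)"
      by (simp add: algebra_simps power2_eq_square)
    then have "b dvd a * t' - b\<^sup>2 * t - a ^ Suc (Suc (Suc k))"
      using t(3) by (metis dvd_diff dvd_mult dvd_triv_left)
    with eq Suc show ?case by blast
  qed
  from this[of "n - 1"] \<open>0 < n\<close> obtain t :: int where t: "s n = of_int t" "b dvd t - a ^ n"
    by auto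
  have "s n = of_int (2 * b ^ n)" using assms by (simp add: s_def w_def power_divide)
  with t have "t = 2 * b ^ n" by (metis of_int_eq_iff)
  moreover have "b dvd 2 * b ^ n" using \<open>0 < n\<close> by (simp add: dvd_power)
  ultimately have "b dvd a ^ n" using t(2) by (metis dvd_diff_right_iff)
  moreover have "coprime b (a ^ n)" using ab(3) by (simp add: coprime_commute)
  ultimately have "is_unit b" by (metis coprime_absorb_left)
  with ab have "b = 1" by simp
  with ab show ?thesis by simp
qed

lemma cis_root_of_unity_order:
  assumes "0 < k" and "k < n"
  shows "cis (2 * pi / real n) ^ k \<noteq> 1"
proof
  assume "cis (2 * pi / real n) ^ k = 1"
  then have eq: "cis (2 * pi * real k / real n) = cis (2 * pi * real 0 / real n)"
    unfolding DeMoivre by (simp add: mult_ac)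
  have inj: "inj_on (\<lambda>k. cis (2 * pi * real k / real n)) {..<n}"
    using bij_betw_roots_unity[of n] assms by (simp add: bij_betw_def)
  have "k = 0" by (rule inj_onD[OF inj eq]) (use assms in auto)
  with assms show False by simp
qed

section \<open>Dickson polynomials with all values in a fibre rational\<close>

text \<open>The cofactors form a Lucas sequence, whose recurrence has the rational coefficients
  \<open>u + v\<close> and \<open>- (u * v)\<close>. Stating a product instead of a quotient covers
  \<open>u = v\<close>.\<close>

lemma power_diff_cofactor_rational:
  fixes u v :: "'a::field_char_0"
  assumes "u + v \<in> \<rat>" and "u * v \<in> \<rat>"
  shows "\<exists>q\<in>\<rat>. u ^ n - v ^ n = (u - v) * q"
proof -
  have "(\<exists>q\<in>\<rat>. u ^ n - v ^ n = (u - v) * q) \<and> (\<exists>q\<in>\<rat>. u ^ Suc n - v ^ Suc n = (u - v) * q)"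
  proof (induction n)
    case 0
    show ?case by (auto intro: bexI[of _ 0] bexI[of _ 1])
  next
    case (Suc n)
    then obtain q q' where q: "q \<in> \<rat>" "q' \<in> \<rat>"
      "u ^ n - v ^ n = (u - v) * q" "u ^ Suc n - v ^ Suc n = (u - v) * q'" by blast
    have "u ^ Suc (Suc n) - v ^ Suc (Suc n) =
        (u + v) * (u ^ Suc n - v ^ Suc n) - u * v * (u ^ n - v ^ n)"
      by (simp add: algebra_simps)
    also have "\<dots> = (u - v) * ((u + v) * q' - u * v * q)"
      unfolding q by (simp add: algebra_simps)
    finally have "\<exists>q\<in>\<rat>. u ^ Suc (Suc n) - v ^ Suc (Suc n) = (u - v) * q"
      using q assms by (intro bexI[of _ "(u + v) * q' - u * v * q"]) auto
    with Suc show ?case by blast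
  qed
  then show ?thesis ..
qed

text \<open>The powers \<open>u ^ n\<close> and \<open>(\<delta> / u) ^ n\<close> are taken to be
  the two roots of t^2 - R t + \<delta>^n, found by the quadratic formula.\<close>

lemma dickson_parametrised_root:
  fixes R \<delta> :: complex
  assumes "0 < n" and "\<delta> \<noteq> 0"
  obtains u where "u \<noteq> 0" and "u ^ n + (\<delta> / u) ^ n = R"
proof -
  obtain d where d: "d\<^sup>2 = R\<^sup>2 - 4 * \<delta> ^ n" using nth_root_exists[of 2] by auto
  obtain u where u: "u ^ n = (R + d) / 2" using nth_root_exists[OF \<open>0 < n\<close>] by blast
  have prod: "(R + d) / 2 * ((R - d) / 2) = \<delta> ^ n"
    using d by (simp add: field_simps power2_eq_square)
  then have nz: "u ^ n \<noteq> 0" using \<open>\<delta> \<noteq> 0\<close> unfolding u by auto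
  then have "u \<noteq> 0" using \<open>0 < n\<close> by (metis power_0_left neq0_conv)
  moreover have "(\<delta> / u) ^ n = (R - d) / 2"
    using prod nz unfolding u[symmetric] by (simp add: power_divide field_simps)
  moreover have "(R + d) / 2 + (R - d) / 2 = R" by (simp add: field_simps)
  ultimately show thesis using that[of u] unfolding u by metis
qed

text \<open>Up to squares this is \<open>4 - (2 cos (2 \<pi> / n))\<^sup>2\<close> for \<open>n \<in> {3, 4, 6}\<close>.\<close>

definition root_cofactor :: "nat \<Rightarrow> rat" where
  "root_cofactor n = (if n = 4 then 1 else 3)"

text \<open>The roots of \<open>D\<^sub>n(x, \<delta>) = R\<close> are \<open>\<zeta>\<^sup>k u + \<delta> / (\<zeta>\<^sup>k u)\<close> with \<open>\<zeta>\<close> a primitive \<open>n\<close>-th root of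
  unity. The sum of the roots with indices \<open>k - 1\<close> and \<open>k + 1\<close> is \<open>\<zeta> + \<zeta>\<^sup>-\<^sup>1\<close> times the
  one with index \<open>k\<close>, and for \<open>k = 0\<close> their difference is \<open>(\<zeta> - \<zeta>\<^sup>-\<^sup>1) (u - \<delta> / u)\<close>.\<close>

lemma dickson_all_roots_rational:
  fixes R \<delta> :: rat
  assumes "3 \<le> n" and "\<delta> \<noteq> 0"
    and rat: "\<And>y::complex. poly (map_poly of_rat (dickson n \<delta>)) y = of_rat R \<Longrightarrow> y \<in> \<rat>"
  shows "n \<in> {3, 4, 6}"
    and "\<exists>q. root_cofactor n * (4 * \<delta> ^ n - R\<^sup>2) = q\<^sup>2"
proof -
  define d where "d = (of_rat \<delta> :: complex)"
  have n: "0 < n" and d: "d \<noteq> 0" "d \<in> \<rat>" using assms by (auto simp: d_def)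
  obtain u where u: "u \<noteq> 0" "u ^ n + (d / u) ^ n = of_rat R"
    using dickson_parametrised_root[OF n d(1)] by blast
  define \<zeta> where "\<zeta> = cis (2 * pi / real n)"
  have \<zeta>n: "\<zeta> ^ n = 1" using n by (simp add: \<zeta>_def DeMoivre)
  have \<zeta>: "\<zeta> \<noteq> 0" "cmod \<zeta> = 1" by (auto simp: \<zeta>_def)
  have \<zeta>k: "k < n \<Longrightarrow> 0 < k \<Longrightarrow> \<zeta> ^ k \<noteq> 1" for k
    unfolding \<zeta>_def by (rule cis_root_of_unity_order)
  have root: "z * u + d / (z * u) \<in> \<rat>" if z: "z ^ n = 1" for z
  proof (rule rat)
    have "z \<noteq> 0" using z n by (auto simp: power_0_left)
    then have "poly (map_poly of_rat (dickson n \<delta>)) (z * u + d / (z * u)) = (z * u) ^ n + (d / (z * u)) ^ n"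
      using n u by (intro poly_dickson) (auto simp: d_def)
    also have "\<dots> = of_rat R"
      using u z by (simp add: power_mult_distrib power_divide)
    finally show "poly (map_poly of_rat (dickson n \<delta>)) (z * u + d / (z * u)) = of_rat R" .
  qed
  define c where "c = \<zeta> + 1 / \<zeta>"
  have x0: "u + d / u \<in> \<rat>" using root[of 1] by simp
  have x1: "\<zeta> * u + d / (\<zeta> * u) \<in> \<rat>" using \<zeta>n by (rule root)
  have x2: "\<zeta>\<^sup>2 * u + d / (\<zeta>\<^sup>2 * u) \<in> \<rat>"
    by (rule root) (use \<zeta>n in \<open>metis power_commutes power_mult power_one mult.commute\<close>)
  have xm: "1 / \<zeta> * u + d / (1 / \<zeta> * u) \<in> \<rat>"
    by (rule root) (use \<zeta>n in \<open>simp add: power_divide\<close>)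
  have "c \<in> \<rat>"
  proof (cases "u + d / u = 0")
    case False
    have "c = (\<zeta> * u + d / (\<zeta> * u) + (1 / \<zeta> * u + d / (1 / \<zeta> * u))) / (u + d / u)"
      unfolding nonzero_eq_divide_eq[OF False] using u \<zeta> by (simp add: c_def field_simps)
    then show ?thesis using x0 x1 xm by simp
  next
    case True
    \<comment> \<open>If the root with index 0 vanishes, the one with index 1 serves as divisor:
      were both zero, u^2 and (\<zeta> u)^2 would both be -d, forcing \<zeta>^2 = 1.\<close>
    have nz: "\<zeta> * u + d / (\<zeta> * u) \<noteq> 0"
    proof
      assume "\<zeta> * u + d / (\<zeta> * u) = 0"
      then have "\<zeta>\<^sup>2 * u\<^sup>2 = - d" using u \<zeta>
        by (simp add: field_simps power2_eq_square add_eq_0_iff2)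
      moreover have "u\<^sup>2 = - d" using True u
        by (simp add: field_simps power2_eq_square add_eq_0_iff2)
      ultimately have "\<zeta>\<^sup>2 = 1" using d by simp
      then show False using \<zeta>k[of 2] \<open>3 \<le> n\<close> by simp
    qed
    have "c = (\<zeta>\<^sup>2 * u + d / (\<zeta>\<^sup>2 * u) + (u + d / u)) / (\<zeta> * u + d / (\<zeta> * u))"
      unfolding nonzero_eq_divide_eq[OF nz] using u \<zeta>
      by (simp add: c_def field_simps power2_eq_square)
    then show ?thesis using x0 x1 x2 by simp
  qed
  then have "c \<in> \<int>" by (rule rational_trace_of_root_of_unity[OF n \<zeta>n c_def])
  then obtain m :: int where m: "c = of_int m" by (elim Ints_cases)
  \<comment> \<open>An integer trace of modulus at most 2 leaves five values, and 2 and -2 would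
    make \<zeta> equal to 1 or -1.\<close>
  have "cmod c \<le> 2"
    unfolding c_def using norm_triangle_ineq[of \<zeta> "1 / \<zeta>"] \<zeta> by (simp add: norm_divide)
  then have "\<bar>m\<bar> \<le> 2" unfolding m by simp
  have quad: "\<zeta>\<^sup>2 = of_int m * \<zeta> - 1"
    using c_def \<zeta> unfolding m by (simp add: field_simps power2_eq_square)
  have z1: "\<zeta> \<noteq> 1" "\<zeta> \<noteq> - 1" using \<zeta>k[of 1] \<zeta>k[of 2] \<open>3 \<le> n\<close> by auto
  have "m \<noteq> 2"
  proof
    assume "m = 2"
    then have "(\<zeta> - 1)\<^sup>2 = 0" using quad by (simp add: power2_diff)
    then show False using z1 by simp
  qed
  moreover have "m \<noteq> -2"
  proof
    assume "m = -2"
    then have "(\<zeta> + 1)\<^sup>2 = 0" using quad by (simp add: power2_sum)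
    then show False using z1 by (simp add: add_eq_0_iff2)
  qed
  ultimately have m_cases: "m = -1 \<or> m = 0 \<or> m = 1" using \<open>\<bar>m\<bar> \<le> 2\<close> by auto
  have cube: "\<zeta> ^ 3 = of_int m * \<zeta>\<^sup>2 - \<zeta>"
  proof -
    have "\<zeta> ^ 3 = \<zeta> * \<zeta>\<^sup>2" by (simp add: power2_eq_square power3_eq_cube)
    also have "\<dots> = \<zeta> * (of_int m * \<zeta> - 1)" unfolding quad ..
    finally show ?thesis by (simp add: power2_eq_square algebra_simps)
  qed
  \<comment> \<open>For m = -1, 0, 1 the quadratic is the cyclotomic polynomial of order 3, 4, 6. A
    power equal to 1 bounds \<open>n\<close> from above; smaller candidates are excluded
    individually.\<close>
  have nm: "n = 4 \<and> m = 0 \<or> n \<in> {3, 6} \<and> m\<^sup>2 = 1"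
    using m_cases
  proof (elim disjE)
    assume m: "m = -1"
    then have "\<zeta> ^ 3 = 1" using cube quad by simp
    then have "n = 3" using \<zeta>k[of 3] \<open>3 \<le> n\<close> by force
    then show ?thesis using m by simp
  next
    assume m: "m = 0"
    then have "\<zeta> ^ 4 = 1" using quad power_mult[of \<zeta> 2 2] by simp
    then have "n \<le> 4" using \<zeta>k[of 4] by force
    moreover have "n \<noteq> 3" using \<zeta>n cube m z1 by (auto simp: minus_equation_iff)
    ultimately show ?thesis using m \<open>3 \<le> n\<close> by auto
  next
    assume m: "m = 1"
    then have c3: "\<zeta> ^ 3 = -1" using quad cube by simp
    then have "\<zeta> ^ 6 = 1" using power_mult[of \<zeta> 3 2] by simp
    then have "n \<le> 6" using \<zeta>k[of 6] by force
    moreover have "n \<noteq> 4"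
      using \<zeta>n c3 z1 by (auto simp: eval_nat_numeral minus_equation_iff)
    moreover have "n \<noteq> 5"
    proof
      assume "n = 5"
      then have "\<zeta> ^ 3 * \<zeta>\<^sup>2 = 1" using \<zeta>n by (simp flip: power_add)
      then have "\<zeta> = 0" using c3 quad m by simp
      then show False using \<zeta> by simp
    qed
    ultimately show ?thesis using m \<open>3 \<le> n\<close> by auto
  qed
  then show "n \<in> {3, 4, 6}" by auto
  define v where "v = d / u"
  have uv: "u + v \<in> \<rat>" "u * v \<in> \<rat>" "u * v = d" using x0 u d by (auto simp: v_def)
  obtain q where q: "q \<in> \<rat>" "u ^ n - v ^ n = (u - v) * q"
    using power_diff_cofactor_rational[OF uv(1,2)] by blast
  \<comment> \<open>\<open>p\<close> is the difference of the rational roots with indices 1 and -1.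
    Since (\<zeta> - 1/\<zeta>)^2 = m^2 - 4, the square of the rational number \<open>p * q\<close>
    is (4 - m^2)(4 \<delta>^n - R^2).\<close>
  define p where "p = (\<zeta> - 1 / \<zeta>) * (u - v)"
  have "p = (\<zeta> * u + d / (\<zeta> * u)) - (1 / \<zeta> * u + d / (1 / \<zeta> * u))"
    using u \<zeta> by (simp add: p_def v_def field_simps)
  then have "p * q \<in> \<rat>" using x1 xm q by simp
  then obtain w where w: "p * q = of_rat w" by (elim Rats_cases)
  have R: "of_rat R = u ^ n + v ^ n" using u(2) by (simp add: v_def)
  have "4 * d ^ n - of_rat R ^ 2 = - ((u ^ n - v ^ n)\<^sup>2)"
    unfolding R uv(3)[symmetric]
    by (simp add: power2_eq_square power_mult_distrib algebra_simps)
  then have X: "4 * d ^ n - of_rat R ^ 2 = - (((u - v) * q)\<^sup>2)" unfolding q(2) .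
  have S: "(\<zeta> - 1 / \<zeta>)\<^sup>2 = of_int m ^ 2 - 4"
    unfolding m[symmetric] c_def using \<zeta> by (simp add: power2_eq_square field_simps)
  have "(p * q)\<^sup>2 = (\<zeta> - 1 / \<zeta>)\<^sup>2 * ((u - v) * q)\<^sup>2"
    unfolding p_def power_mult_distrib by simp
  also have "\<dots> = (4 - of_int m ^ 2) * (4 * d ^ n - of_rat R ^ 2)"
    unfolding X S by (simp only: minus_diff_eq[symmetric, of "4 :: complex"] minus_mult_minus)
  finally have "(4 - of_int m ^ 2) * (4 * d ^ n - of_rat R ^ 2) = (p * q)\<^sup>2" ..
  then have "of_rat ((4 - of_int (m\<^sup>2)) * (4 * \<delta> ^ n - R\<^sup>2)) = (of_rat (w\<^sup>2) :: complex)"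
    unfolding w d_def by (simp add: of_rat_mult of_rat_diff of_rat_power)
  then have key: "(4 - of_int (m\<^sup>2)) * (4 * \<delta> ^ n - R\<^sup>2) = w\<^sup>2"
    by (simp only: of_rat_eq_iff)
  from nm show "\<exists>q. root_cofactor n * (4 * \<delta> ^ n - R\<^sup>2) = q\<^sup>2"
  proof (elim disjE conjE)
    assume "n = 4" "m = 0"
    then show ?thesis using key
      by (intro exI[of _ "w / 2"]) (simp add: root_cofactor_def power_divide)
  next
    assume "n \<in> {3, 6}" "m\<^sup>2 = 1"
    then show ?thesis using key
      by (intro exI[of _ w]) (auto simp: root_cofactor_def)
  qed
qed

section \<open>Fibres inherited from a composition\<close>

text \<open>Simplicity is expressed by a nonzero derivative rather than by \<open>order\<close>,
  which suits the chain rule and scaling.\<close>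

definition simple_rational_fibre :: "rat poly \<Rightarrow> rat \<Rightarrow> bool" where
  "simple_rational_fibre P r \<longleftrightarrow>
     (\<forall>y::complex. poly (map_poly of_rat P) y = of_rat r \<longrightarrow>
        y \<in> \<rat> \<and> poly (map_poly of_rat (pderiv P)) y \<noteq> 0)"

lemma degree_1_poly_surj:
  fixes p :: "'a::field poly"
  assumes "degree p = 1"
  obtains z where "poly p z = y"
proof -
  obtain a b where p: "p = [:b, a:]" "a \<noteq> 0"
    using assms by (metis degree_pCons_eq_if degree_eq_zeroE pCons_cases One_nat_def nat.inject
        zero_neq_one pCons_eq_0_iff)
  show thesis by (rule that[of "(y - b) / a"]) (use p in simp)
qed

text \<open>Every \<open>y\<close> in the fibre of \<open>F\<close> over \<open>r\<close> is the
  value of \<kappa> at a root of the composition. That root is rational, hence so is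
  \<open>y\<close>; it is simple, and by the chain rule the derivative of \<open>F\<close> at
  \<open>y\<close> is a factor of a nonzero number.\<close>

lemma simple_rational_fibre_of_composition:
  fixes r :: complex
  assumes "only_simple_rational_roots (pcompose \<phi> (pcompose F \<kappa>))"
    and "pcompose \<phi> (pcompose F \<kappa>) \<noteq> 0"
    and "degree \<kappa> = 1" and "degree F > 0"
    and r: "poly (map_poly of_rat \<phi>) r = 0"
  shows "\<exists>s. r = of_rat s \<and> simple_rational_fibre F s"
proof -
  define f where "f = pcompose \<phi> (pcompose F \<kappa>)"
  define c :: "rat poly \<Rightarrow> complex poly" where "c = map_poly of_rat"
  have fibre: "y \<in> \<rat> \<and> poly (c (pderiv F)) y \<noteq> 0" if y: "poly (c F) y = r" for y
  proof -
    obtain z where z: "poly (c \<kappa>) z = y"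
      using degree_1_poly_surj[of "c \<kappa>" y] assms by (auto simp: c_def)
    have fz: "poly (c f) z = 0"
      using r y z by (simp add: f_def c_def map_poly_of_rat_pcompose poly_pcompose)
    with assms(1) have "z \<in> \<rat>" and ord: "order z (c f) = 1"
      unfolding only_simple_rational_roots_def f_def c_def by blast+
    then obtain z' where "z = of_rat z'" by (elim Rats_cases)
    have "y \<in> \<rat>"
      using z unfolding \<open>z = of_rat z'\<close> c_def poly_map_poly_of_rat by auto
    have "c f \<noteq> 0" using assms(2) by (auto simp: c_def f_def poly_eq_iff coeff_map_poly)
    then have "order z (pderiv (c f)) = 0" using order_pderiv[OF _ fz] ord by simp
    moreover have "pderiv (c f) \<noteq> 0"
      using \<open>c f \<noteq> 0\<close> fz by (metis pderiv_eq_0_iff degree_eq_zeroE poly_const_conv pCons_0_0)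
    ultimately have "poly (pderiv (c f)) z \<noteq> 0" by (simp add: order_root)
    then have "poly (c (pderiv F)) y \<noteq> 0"
      using z by (simp add: f_def c_def map_poly_of_rat_pcompose map_poly_of_rat_pderiv
          pderiv_pcompose poly_pcompose)
    with \<open>y \<in> \<rat>\<close> show ?thesis by simp
  qed
  \<comment> \<open>As \<open>F\<close> is not constant, the fibre contains some \<open>y\<close>;
    it is rational, so its image \<open>r\<close> is rational too.\<close>
  have "degree (c F - [:r:]) > 0"
    using assms(4) degree_add_eq_left[of "- [:r:]" "c F"]
    by (simp add: c_def del: minus_pCons)
  then obtain y where "poly (c F) y = r"
    using alg_closed_imp_poly_has_root[of "c F - [:r:]"] by auto
  with fibre obtain y' where "y = of_rat y'" by (metis Rats_cases)
  then have rs: "r = of_rat (poly F y')" using \<open>poly (c F) y = r\<close> by (simp add: c_def poly_map_poly_of_rat)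
  then show ?thesis
    using fibre unfolding simple_rational_fibre_def c_def by auto
qed

lemma simple_rational_fibre_smult:
  assumes "simple_rational_fibre (smult k P) r" and "k \<noteq> 0"
  shows "simple_rational_fibre P (r / k)"
  unfolding simple_rational_fibre_def
proof (intro allI impI)
  fix y :: complex
  assume "poly (map_poly of_rat P) y = of_rat (r / k)"
  then have "poly (map_poly of_rat (smult k P)) y = of_rat r"
    using \<open>k \<noteq> 0\<close> by (simp add: map_poly_of_rat_smult of_rat_divide)
  with assms(1) show "y \<in> \<rat> \<and> poly (map_poly of_rat (pderiv P)) y \<noteq> 0"
    unfolding simple_rational_fibre_def by (auto simp: pderiv_smult map_poly_of_rat_smult)
qed

section \<open>The arithmetic obstruction to two large indices\<close>

text \<open>Degeneracy means R = 2 \<delta>^2 or R = -2 \<delta>^2. Then D_4 - R is x^2 (x^2 - 4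
  \<delta>) or (x^2 - 2 \<delta>)^2, which has a multiple root.\<close>

lemma dickson_4_fibre_nondegenerate:
  assumes "simple_rational_fibre (dickson 4 \<delta>) R"
  shows "4 * \<delta> ^ 4 - R\<^sup>2 \<noteq> 0"
proof
  assume "4 * \<delta> ^ 4 - R\<^sup>2 = 0"
  then have "(2 * \<delta>\<^sup>2 - R) * (2 * \<delta>\<^sup>2 + R) = 0"
    by (simp add: algebra_simps power2_eq_square eval_nat_numeral)
  then consider "R = 2 * \<delta>\<^sup>2" | "R = - (2 * \<delta>\<^sup>2)"
    by (auto simp: add_eq_0_iff)
  then show False
  proof cases
    case 1
    then have "poly (map_poly of_rat (dickson 4 \<delta>)) (0 :: complex) = of_rat R"
      by (simp add: dickson_4 map_poly_pCons)
    then have "poly (map_poly of_rat (pderiv (dickson 4 \<delta>))) (0 :: complex) \<noteq> 0"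
      using assms unfolding simple_rational_fibre_def by blast
    then show False by (simp add: dickson_4 pderiv_pCons map_poly_pCons)
  next
    case 2
    define e where "e = (of_rat \<delta> :: complex)"
    obtain y :: complex where y: "y\<^sup>2 = 2 * e" using nth_root_exists[of 2] by auto
    have "poly (map_poly of_rat (dickson 4 \<delta>)) y = 2 * e\<^sup>2 - 4 * e * y\<^sup>2 + (y\<^sup>2)\<^sup>2"
      by (simp add: dickson_4 map_poly_pCons of_rat_mult of_rat_power of_rat_minus e_def
          power2_eq_square algebra_simps)
    also have "\<dots> = of_rat R"
      unfolding y 2 by (simp add: e_def of_rat_minus of_rat_mult of_rat_power power2_eq_square)
    finally have "poly (map_poly of_rat (pderiv (dickson 4 \<delta>))) y \<noteq> 0"
      using assms unfolding simple_rational_fibre_def by blast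
    moreover have "poly (map_poly of_rat (pderiv (dickson 4 \<delta>))) y = 4 * y * (y\<^sup>2 - 2 * e)"
      by (simp add: dickson_4 pderiv_pCons map_poly_pCons of_rat_mult of_rat_minus e_def
          power2_eq_square algebra_simps)
    ultimately show False using y by simp
  qed
qed

text \<open>Otherwise \<open>x / y\<close> would be a rational algebraic integer, hence an integer,
  with square 3.\<close>

lemma square_eq_3_times_square:
  fixes x y :: rat
  assumes "x\<^sup>2 = 3 * y\<^sup>2"
  shows "y = 0"
proof (rule ccontr)
  assume "y \<noteq> 0"
  then have sq: "(x / y)\<^sup>2 = 3" using assms by (simp add: power_divide)
  have "algebraic_int (x / y)"
  proof (rule algebraic_int.intros)
    show "\<forall>i. coeff [:-3, 0, 1 :: rat:] i \<in> \<int>" by (simp add: coeff_pCons split: nat.split)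
    show "poly [:-3, 0, 1:] (x / y) = 0"
      using sq by (simp add: power2_eq_square)
  qed simp
  moreover have "x / y \<in> \<rat>"
    using Rats_of_rat[where 'a = rat, of "x / y"] by simp
  ultimately have "x / y \<in> \<int>" by (rule rational_algebraic_int_is_int)
  then obtain m where "x / y = of_int m" by (elim Ints_cases)
  with sq have "of_int (m\<^sup>2) = (of_int 3 :: rat)" by simp
  then have m: "\<bar>m\<bar>\<^sup>2 = 3" by (simp only: of_int_eq_iff power2_abs)
  then have "\<bar>m\<bar> < 2"
    using power_less_imp_less_base[of "\<bar>m\<bar>" 2 2] by simp
  then have "m = 0 \<or> m = 1 \<or> m = - 1" by arith
  with m show False by auto
qed

text \<open>\<open>K\<close> is the common value of the two discriminants up to the squares of
  \<open>a\<close> and \<open>b\<close>. Both indices lie in {3, 4, 6}, and the gcd condition rules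
  out equal indices and the pair 3, 6, so exactly one is 4. Then \<open>K\<close> is a nonzero
  square and so is \<open>3 * K\<close>.\<close>

lemma no_common_fibre:
  fixes K :: rat
  assumes "simple_rational_fibre (dickson \<mu> \<gamma>) R" and "simple_rational_fibre (dickson \<nu> \<delta>) S"
    and "3 \<le> \<mu>" and "3 \<le> \<nu>" and "gcd \<mu> \<nu> \<in> {1, 2}" and "\<gamma> \<noteq> 0" and "\<delta> \<noteq> 0"
    and A: "4 * \<gamma> ^ \<mu> - R\<^sup>2 = a\<^sup>2 * K" and B: "4 * \<delta> ^ \<nu> - S\<^sup>2 = b\<^sup>2 * K"
    and "a \<noteq> 0" and "b \<noteq> 0"
  shows False
proof -
  have split: "n \<in> {3, 4, 6} \<and> (\<exists>q. root_cofactor n * K = q\<^sup>2) \<and> (n = 4 \<longrightarrow> K \<noteq> 0)"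
    if fib: "simple_rational_fibre (dickson n e) T" and "3 \<le> n" and "e \<noteq> 0"
      and eq: "4 * e ^ n - T\<^sup>2 = c\<^sup>2 * K" and "c \<noteq> 0"
    for n T and e c :: rat
  proof -
    have rat: "poly (map_poly of_rat (dickson n e)) y = of_rat T \<Longrightarrow> y \<in> \<rat>" for y :: complex
      using fib unfolding simple_rational_fibre_def by blast
    have n: "n \<in> {3, 4, 6}"
      using \<open>3 \<le> n\<close> \<open>e \<noteq> 0\<close> rat by (rule dickson_all_roots_rational(1))
    have "\<exists>q. root_cofactor n * (4 * e ^ n - T\<^sup>2) = q\<^sup>2"
      using \<open>3 \<le> n\<close> \<open>e \<noteq> 0\<close> rat by (rule dickson_all_roots_rational(2))
    then obtain q where "root_cofactor n * (c\<^sup>2 * K) = q\<^sup>2" unfolding eq by blast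
    then have "root_cofactor n * K = (q / c)\<^sup>2"
      using \<open>c \<noteq> 0\<close> by (simp add: power_divide field_simps)
    moreover have "n = 4 \<longrightarrow> K \<noteq> 0"
      using dickson_4_fibre_nondegenerate[of e T] fib eq by auto
    ultimately show ?thesis using n by blast
  qed
  note \<mu> = split[OF assms(1,3,6) A \<open>a \<noteq> 0\<close>] and \<nu> = split[OF assms(2,4,7) B \<open>b \<noteq> 0\<close>]
  have "\<mu> = 4 \<and> \<nu> \<noteq> 4 \<or> \<mu> \<noteq> 4 \<and> \<nu> = 4"
    using \<mu> \<nu> \<open>gcd \<mu> \<nu> \<in> {1, 2}\<close> by (auto simp: gcd_nat.simps[of _ "_::nat"])
  then have "K \<noteq> 0" "\<exists>p. K = p\<^sup>2" "\<exists>q. 3 * K = q\<^sup>2"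
    using \<mu> \<nu> by (auto simp: root_cofactor_def)
  then show False using square_eq_3_times_square by (metis zero_power2)
qed

lemma standard_pair_no_common_fibre:
  assumes pair: "standard_pair_third_kind F G \<or> standard_pair_fourth_kind F G"
    and "simple_rational_fibre F r" and "simple_rational_fibre G r"
    and "3 \<le> degree F" and "3 \<le> degree G"
  shows False
  using pair
proof
  assume "standard_pair_third_kind F G"
  then obtain \<alpha> \<mu> \<nu> where par: "\<alpha> \<noteq> 0" "gcd \<mu> \<nu> = 1"
    and FG: "(F, G) = (dickson \<mu> (\<alpha> ^ \<nu>), dickson \<nu> (\<alpha> ^ \<mu>)) \<or>
      (G, F) = (dickson \<mu> (\<alpha> ^ \<nu>), dickson \<nu> (\<alpha> ^ \<mu>))"
    unfolding standard_pair_third_kind_def by metis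
  from FG have fib: "simple_rational_fibre (dickson \<mu> (\<alpha> ^ \<nu>)) r" "simple_rational_fibre (dickson \<nu> (\<alpha> ^ \<mu>)) r"
    and "3 \<le> \<mu>" "3 \<le> \<nu>"
    using assms degree_dickson_le[of \<mu> "\<alpha> ^ \<nu>"] degree_dickson_le[of \<nu> "\<alpha> ^ \<mu>"] by auto
  \<comment> \<open>Both discriminants equal the same number, because the powers of \<alpha> agree:
    (\<alpha>^\<nu>)^\<mu> = (\<alpha>^\<mu>)^\<nu>.\<close>
  then show False
    using par no_common_fibre[OF fib, of 1 "4 * \<alpha> ^ (\<mu> * \<nu>) - r\<^sup>2" 1]
    by (simp add: mult.commute flip: power_mult)
next
  assume "standard_pair_fourth_kind F G"
  then obtain \<alpha> \<beta> \<mu> \<nu> where par: "\<alpha> \<noteq> 0" "\<beta> \<noteq> 0" "gcd \<mu> \<nu> = 2"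
    and FG: "(F, G) = (smult (\<alpha> powi (- int (\<mu> div 2))) (dickson \<mu> \<alpha>),
                   - smult (\<beta> powi (- int (\<nu> div 2))) (dickson \<nu> \<beta>)) \<or>
         (G, F) = (smult (\<alpha> powi (- int (\<mu> div 2))) (dickson \<mu> \<alpha>),
                   - smult (\<beta> powi (- int (\<nu> div 2))) (dickson \<nu> \<beta>))"
    unfolding standard_pair_fourth_kind_def by metis
  define A where "A = \<alpha> ^ (\<mu> div 2)"
  define B where "B = \<beta> ^ (\<nu> div 2)"
  have nz: "A \<noteq> 0" "B \<noteq> 0" using par by (auto simp: A_def B_def)
  have "even \<mu>" "even \<nu>" using par(3) by (metis gcd_dvd1, metis gcd_dvd2)
  then have sq: "\<alpha> ^ \<mu> = A\<^sup>2" "\<beta> ^ \<nu> = B\<^sup>2"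
    by (auto simp: A_def B_def simp flip: power_mult)
  have FG': "(F, G) = (smult (1 / A) (dickson \<mu> \<alpha>), smult (- 1 / B) (dickson \<nu> \<beta>)) \<or>
      (G, F) = (smult (1 / A) (dickson \<mu> \<alpha>), smult (- 1 / B) (dickson \<nu> \<beta>))"
    using FG by (simp add: A_def B_def power_int_minus divide_inverse)
  then have "3 \<le> \<mu>" "3 \<le> \<nu>"
    using assms(4,5) nz degree_dickson_le[of \<mu> \<alpha>] degree_dickson_le[of \<nu> \<beta>]
    by (auto split: if_splits)
  moreover have "simple_rational_fibre (smult (1 / A) (dickson \<mu> \<alpha>)) r"
    "simple_rational_fibre (smult (- 1 / B) (dickson \<nu> \<beta>)) r"
    using FG' assms(2,3) by auto
  note fib = this[THEN simple_rational_fibre_smult]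
  \<comment> \<open>Scaling moves into the fibre value. The sign of the second polynomial disappears
    on squaring, and the common value is 4 - r^2, with square factors \<open>A\<close> and
    \<open>B\<close>.\<close>
  have "simple_rational_fibre (dickson \<mu> \<alpha>) (r * A)" "simple_rational_fibre (dickson \<nu> \<beta>) (- r * B)"
    using fib nz by auto
  moreover have "4 * \<alpha> ^ \<mu> - (r * A)\<^sup>2 = A\<^sup>2 * (4 - r\<^sup>2)" "4 * \<beta> ^ \<nu> - (- r * B)\<^sup>2 = B\<^sup>2 * (4 - r\<^sup>2)"
    by (simp_all add: sq power_mult_distrib algebra_simps)
  moreover have "gcd \<mu> \<nu> \<in> {1, 2}" using par by simp
  ultimately show False
    using no_common_fibre par nz by blast
qed

theorem theorem8p1:
  fixes f g \<phi> F G \<kappa> \<eta> :: "rat poly"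
  assumes "degree f > 0"
    and "only_simple_rational_roots f"
    and "only_simple_rational_roots g"
    and "degree f \<le> degree g"
    and "inf_many_sols_bounded_denom f g"
    and "degree \<kappa> = 1" and "degree \<eta> = 1"
    and "f = pcompose \<phi> (pcompose F \<kappa>)"
    and "g = pcompose \<phi> (pcompose G \<eta>)"
    and "standard_pair_third_kind F G \<or> standard_pair_fourth_kind F G"
    and "inf_many_sols_bounded_denom F G"
  shows "degree F \<le> 2"
proof (rule ccontr)
  assume "\<not> degree F \<le> 2"
  \<comment> \<open>The factor deg \<phi> is common and positive, so the comparison of
    \<open>f\<close> with \<open>g\<close> passes to \<open>F\<close> and \<open>G\<close>, and
    \<open>G\<close> has degree at least 3 as well.\<close>
  have deg: "degree f = degree \<phi> * degree F" "degree g = degree \<phi> * degree G"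
    using assms by (simp_all add: degree_pcompose)
  with assms(1,4) have "degree \<phi> > 0" "degree F \<le> degree G" by auto
  with \<open>\<not> degree F \<le> 2\<close> have big: "3 \<le> degree F" "3 \<le> degree G" by auto
  obtain r :: complex where r: "poly (map_poly of_rat \<phi>) r = 0"
    using alg_closed_imp_poly_has_root[of "map_poly of_rat \<phi> :: complex poly"] \<open>degree \<phi> > 0\<close> by auto
  have "f \<noteq> 0" "g \<noteq> 0" using assms(1,4) by auto
  then obtain s t where "r = of_rat s" "simple_rational_fibre F s"
    and "r = of_rat t" "simple_rational_fibre G t"
    using simple_rational_fibre_of_composition[OF _ _ _ _ r, of F \<kappa>]
      simple_rational_fibre_of_composition[OF _ _ _ _ r, of G \<eta>] assms big by auto
  moreover from this have "s = t" by simp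
  ultimately show False
    using standard_pair_no_common_fibre[OF assms(10)] big by blast
qed

end
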